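(* Let $X$ be a separable Banach space with the $\lambda$-UBAP and let $\varepsilon>0$. Then there exists a Schauder frame $\{(x_n,f_n)\}_{n\in\mathbb{N}_+}\subseteq X\times X^*$ of $X$ (i.e. $x=\sum_{n=1}^{\infty}f_n(x)x_n$ for all $x\in X$) and a subsequence $\{N_k\}_{k=1}^\infty$ of $\mathbb{N}_+$ such that $$\sup_{N\in\mathbb{N}_+,\ \theta_k=\pm1}\left\|\sum_{k=1}^{N}\theta_k\sum_{n=N_k+1}^{N_{k+1}}f_n\otimes x_n\right\|\le\lambda+\varepsilon\quad\text{and}\quad \sup_{N\in\mathbb{N}_+}\left\|\sum_{n=1}^{N}f_n\otimes x_n\right\|\le\lambda+\varepsilon .$$ (In particular the Schauder frame is block unconditional.) In addition, the frame can be chosen so that $\|x_n\|=1$ and $\|f_n\|\le1$ for all $n\in\mathbb{N}_+$.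
   Context: $\mathbb{N}_+$ is the set of positive integers. For $f\in X^*$ and $b\in X$, $f\otimes b$ is the operator $x\mapsto f(x)b$. Approximating sequence: a sequence $\{S_n\}_{n=1}^\infty$ of bounded finite rank operators on $X$ converging strongly (pointwise in norm) to the identity, with $S_mS_n=S_n$ for all $n<m$ (and hence $\limsup_n\|S_n\|<\infty$). $\lambda$-UBAP ($\lambda$-unconditional bounded approximation property): a separable Banach space $X$ has it if for every $\varepsilon>0$ there is an approximating sequence $\{S_n\}$ such that, with $S_0=0$ and $A_n=S_n-S_{n-1}$, $\sup_{N\in\mathbb{N}_+,\,\theta_i=\pm1}\|\sum_{i=1}^N\theta_iA_i\|\le\lambda+\varepsilon$. Schauder frame of $X$: a sequence $\{(x_n,f_n)\}\subseteq X\times X^*$ with $x=\sum_{n=1}^\infty f_n(x)x_n$ (norm convergence) for all $x\in X$. It is block unconditional if there is a subsequence $\{N_k\}$ of $\mathbb{N}_+$ with $\sup_{N,\theta_k=\pm1}\|\sum_{k=1}^{N}\theta_k\sum_{n=N_k+1}^{N_{k+1}}f_n\otimes x_n\|<\infty$. *)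

theory Defs
  imports "HOL-Analysis.Analysis"
begin

(* Bounded operators on X are the elements of X \<Rightarrow>\<^sub>L X with the operator norm, and X^* is
   X \<Rightarrow>\<^sub>L real.  All sequences indexed by the positive integers are functions on nat of which
   only the values at indices \<ge> 1 are relevant. *)

(* f \<otimes> b, i.e. x \<mapsto> f(x) b *)
definition rank_one :: "('a::real_normed_vector \<Rightarrow>\<^sub>L real) \<Rightarrow> 'b::real_normed_vector \<Rightarrow> ('a \<Rightarrow>\<^sub>L 'b)"
  where "rank_one f b = blinfun_scaleR_left b o\<^sub>L f"

lemma rank_one_apply [simp]: "rank_one f b x = f x *\<^sub>R b"
  by (simp add: rank_one_def)

definition finite_rank :: "('a::real_normed_vector \<Rightarrow>\<^sub>L 'b::real_normed_vector) \<Rightarrow> bool"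
  where "finite_rank T \<longleftrightarrow> (\<exists>B. finite B \<and> range (blinfun_apply T) = span B)"

definition approximating_sequence :: "(nat \<Rightarrow> ('a::banach \<Rightarrow>\<^sub>L 'a)) \<Rightarrow> bool"
  where "approximating_sequence S \<longleftrightarrow>
    (\<forall>n\<ge>1. finite_rank (S n)) \<and>
    (\<forall>x. (\<lambda>n. S n x) \<longlonglongrightarrow> x) \<and>
    (\<forall>n m. 1 \<le> n \<longrightarrow> n < m \<longrightarrow> S m o\<^sub>L S n = S n)"

(* The supremum is taken in ereal, so that it is \<infinity> when the norms are unbounded
   (Sup on the reals is unspecified in that case). *)
definition sup_signed_sums :: "(nat \<Rightarrow> ('a::banach \<Rightarrow>\<^sub>L 'a)) \<Rightarrow> ereal"
  where "sup_signed_sums A =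
    (SUP N\<in>{1..}. SUP \<theta>\<in>{\<theta> :: nat \<Rightarrow> real. \<forall>i. \<theta> i = 1 \<or> \<theta> i = -1}.
       ereal (norm (\<Sum>i=1..N. \<theta> i *\<^sub>R A i)))"

lemma sup_signed_sums_le_iff:
  "sup_signed_sums A \<le> ereal c \<longleftrightarrow>
    (\<forall>N\<ge>1. \<forall>\<theta>. (\<forall>i. \<theta> i = 1 \<or> \<theta> i = -1) \<longrightarrow> norm (\<Sum>i=1..N. \<theta> i *\<^sub>R A i) \<le> c)"
  by (auto simp: sup_signed_sums_def SUP_le_iff)

(* S 0 is not part of the approximating sequence; it is fixed to 0 so that A 1 = S 1. *)
definition has_UBAP :: "'a::banach itself \<Rightarrow> real \<Rightarrow> bool"
  where "has_UBAP _ l \<longleftrightarrow>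
    (\<forall>\<epsilon>>0. \<exists>S :: nat \<Rightarrow> ('a \<Rightarrow>\<^sub>L 'a). approximating_sequence S \<and> S 0 = 0 \<and>
       sup_signed_sums (\<lambda>n. S n - S (n - 1)) \<le> ereal (l + \<epsilon>))"

definition schauder_frame :: "(nat \<Rightarrow> 'a::banach) \<Rightarrow> (nat \<Rightarrow> ('a \<Rightarrow>\<^sub>L real)) \<Rightarrow> bool"
  where "schauder_frame x f \<longleftrightarrow> (\<forall>z. (\<lambda>N. \<Sum>n=1..N. f n z *\<^sub>R x n) \<longlonglongrightarrow> z)"

definition pos_subsequence :: "(nat \<Rightarrow> nat) \<Rightarrow> bool"
  where "pos_subsequence N \<longleftrightarrow> (\<forall>k\<ge>1. 1 \<le> N k) \<and> strict_mono_on {1..} N"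

definition frame_block ::
    "(nat \<Rightarrow> 'a::banach) \<Rightarrow> (nat \<Rightarrow> ('a \<Rightarrow>\<^sub>L real)) \<Rightarrow> (nat \<Rightarrow> nat) \<Rightarrow> nat \<Rightarrow> ('a \<Rightarrow>\<^sub>L 'a)"
  where "frame_block x f N k = (\<Sum>n = N k + 1..N (k + 1). rank_one (f n) (x n))"

definition block_unconditional :: "(nat \<Rightarrow> 'a::banach) \<Rightarrow> (nat \<Rightarrow> ('a \<Rightarrow>\<^sub>L real)) \<Rightarrow> bool"
  where "block_unconditional x f \<longleftrightarrow>
    (\<exists>N. pos_subsequence N \<and> sup_signed_sums (frame_block x f N) < \<infinity>)"

end

theory Submission
  imports Defs
begin

text \<open>Each difference \<open>A = S\<^sub>k\<^sub>+\<^sub>1 - S\<^sub>k\<close> of the approximating sequence is a finite sum of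
  operators \<open>g \<otimes> b\<close> with \<open>\<parallel>b\<parallel> = 1\<close>.  Running \<open>M\<close> times through this sum, with every \<open>g\<close> divided by
  \<open>M\<close>, gives \<open>A\<close> again, but now every partial sum is within \<open>O(1/M)\<close> of \<open>t A\<close> for some
  \<open>t \<in> [0, 1]\<close>, and the functionals have norm at most 1.  Concatenating these blocks yields a frame
  whose partial sums are close to the convex combinations \<open>(1 - t) S\<^sub>k + t S\<^sub>k\<^sub>+\<^sub>1\<close>.\<close>

section \<open>Finite rank operators as finite sums of rank one operators\<close>

text \<open>Induction on the basis: the bound for \<open>B\<close> makes \<open>span B\<close>
  closed, so a new vector \<open>a\<close> outside it has positive distance from it, and this
  distance controls the coefficient of \<open>a\<close>. The lemma is what makes the coordinate
  functionals of a finite rank operator bounded.\<close>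

lemma independent_coefficients_bounded:
  fixes B :: "'a::real_normed_vector set"
  assumes "finite B" "independent B"
  shows "\<exists>C\<ge>0. \<forall>c. (\<Sum>b\<in>B. \<bar>c b\<bar>) \<le> C * norm (\<Sum>b\<in>B. c b *\<^sub>R b)"
  using assms
proof (induction B rule: finite_induct)
  case empty
  then show ?case by (intro exI[of _ 0]) simp
next
  case (insert a B)
  have a: "a \<notin> span B" and B: "independent B"
    using insert.prems insert.hyps by (auto simp: independent_insert)
  obtain C where C: "C \<ge> 0" "\<And>c. (\<Sum>b\<in>B. \<bar>c b\<bar>) \<le> C * norm (\<Sum>b\<in>B. c b *\<^sub>R b)"
    using insert.IH[OF B] by blast
  \<comment> \<open>If a sequence in \<open>span B\<close> converges to \<open>a\<close>, then by
    the bound for \<open>B\<close> its coefficients are Cauchy sequences of reals; their limits are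
    coefficients of \<open>a\<close>, which would put \<open>a\<close> into
    \<open>span B\<close>.\<close>
  have "a \<notin> closure (span B)"
  proof
    assume "a \<in> closure (span B)"
    then obtain y where y: "\<And>n. y n \<in> span B" "y \<longlonglongrightarrow> a"
      by (auto simp: closure_sequential)
    have "\<forall>n. \<exists>c. y n = (\<Sum>b\<in>B. c b *\<^sub>R b)"
      using y(1) span_finite[OF insert.hyps(1)] by auto
    then obtain c where c: "\<And>n. y n = (\<Sum>b\<in>B. c n b *\<^sub>R b)" by metis
    have le: "\<bar>c m b - c n b\<bar> \<le> C * norm (y m - y n)" if "b \<in> B" for b m n
    proof -
      have "\<bar>c m b - c n b\<bar> \<le> (\<Sum>b\<in>B. \<bar>c m b - c n b\<bar>)"
        using that insert.hyps(1) by (intro member_le_sum) auto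
      also have "\<dots> \<le> C * norm (\<Sum>b\<in>B. (c m b - c n b) *\<^sub>R b)"
        by (rule C(2))
      also have "(\<Sum>b\<in>B. (c m b - c n b) *\<^sub>R b) = y m - y n"
        by (simp add: c scaleR_diff_left sum_subtractf)
      finally show ?thesis .
    qed
    have "Cauchy (\<lambda>n. c n b)" if "b \<in> B" for b
    proof (rule metric_CauchyI)
      fix e :: real assume "e > 0"
      \<comment> \<open>\<open>C\<close> may be 0, so the division is by
        \<open>C + 1\<close>.\<close>
      then have "e / (C + 1) > 0" using C(1) by simp
      moreover have "Cauchy y" using y(2) LIMSEQ_imp_Cauchy by blast
      ultimately obtain n0 where n0: "\<And>m n. m \<ge> n0 \<Longrightarrow> n \<ge> n0 \<Longrightarrow> dist (y m) (y n) < e / (C + 1)"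
        using metric_CauchyD by metis
      have "dist (c m b) (c n b) < e" if "m \<ge> n0" "n \<ge> n0" for m n
      proof -
        have "dist (c m b) (c n b) \<le> C * norm (y m - y n)"
          using le[OF \<open>b \<in> B\<close>] by (simp add: dist_real_def)
        also have "\<dots> \<le> (C + 1) * norm (y m - y n)"
          by (intro mult_right_mono) auto
        also have "\<dots> < e"
          using n0[OF that] C(1) by (simp add: dist_norm field_simps)
        finally show ?thesis .
      qed
      then show "\<exists>M. \<forall>m\<ge>M. \<forall>n\<ge>M. dist (c m b) (c n b) < e" by blast
    qed
    then have "\<forall>b\<in>B. \<exists>d. (\<lambda>n. c n b) \<longlonglongrightarrow> d"
      by (simp add: Cauchy_convergent_iff convergent_def)
    then obtain d where d: "\<And>b. b \<in> B \<Longrightarrow> (\<lambda>n. c n b) \<longlonglongrightarrow> d b" by metis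
    have "y \<longlonglongrightarrow> (\<Sum>b\<in>B. d b *\<^sub>R b)"
      unfolding c by (intro tendsto_intros d)
    then have "a = (\<Sum>b\<in>B. d b *\<^sub>R b)" using y(2) LIMSEQ_unique by blast
    then show False using a by (auto intro: span_sum span_scale span_base)
  qed
  then obtain e where e: "e > 0" "\<And>y. y \<in> span B \<Longrightarrow> dist y a \<ge> e"
    by (metis closure_approachable not_less)
  \<comment> \<open>The term \<open>1/e\<close> pays for the coefficient of \<open>a\<close>. The
    rest is \<open>C\<close> times the bound for the part in \<open>span B\<close>, which is the
    whole sum minus its \<open>a\<close> term.\<close>
  have *: "(\<Sum>b\<in>insert a B. \<bar>c b\<bar>) \<le> (1/e + C * (1 + norm a / e)) * norm (\<Sum>b\<in>insert a B. c b *\<^sub>R b)"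
    for c
  proof -
    define y where "y = (\<Sum>b\<in>B. c b *\<^sub>R b)"
    define s where "s = c a *\<^sub>R a + y"
    have ca: "\<bar>c a\<bar> \<le> norm s / e"
    proof (cases "c a = 0")
      case False
      \<comment> \<open>Dividing \<open>s\<close> by \<open>c a\<close> gives \<open>a\<close> minus
        this element of \<open>span B\<close>, hence a vector of norm at least
        \<open>e\<close>.\<close>
      have "(- 1 / c a) *\<^sub>R y \<in> span B"
        unfolding y_def by (intro span_scale span_sum span_base)
      from e(2)[OF this] have "e \<le> norm ((1 / c a) *\<^sub>R s)"
        using False by (simp add: dist_norm s_def scaleR_add_right norm_minus_commute algebra_simps)
      then show ?thesis using e(1) False by (simp add: field_simps)
    qed (use e in simp)
    have "norm y \<le> norm s + \<bar>c a\<bar> * norm a"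
      using norm_triangle_ineq4[of s "c a *\<^sub>R a"] by (simp add: s_def)
    also have "\<dots> \<le> norm s + norm s / e * norm a"
      using ca by (intro add_left_mono mult_right_mono) auto
    finally have "C * norm y \<le> C * (norm s + norm s / e * norm a)"
      using C(1) by (intro mult_left_mono)
    then have "\<bar>c a\<bar> + (\<Sum>b\<in>B. \<bar>c b\<bar>) \<le> norm s / e + C * (norm s + norm s / e * norm a)"
      using ca C(2)[of c] by (simp add: y_def)
    also have "\<dots> = (1/e + C * (1 + norm a / e)) * norm s"
      by (simp add: field_simps)
    finally show ?thesis
      using insert.hyps by (simp add: s_def y_def)
  qed
  then show ?case using e(1) C(1)
    by (intro exI[of _ "1/e + C * (1 + norm a / e)"]) auto
qed

text \<open>Lists, since both the order of the terms and their repetitions matter: prefixes of the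
  list become partial sums of the frame.\<close>

definition rank_one_sum ::
    "(('a::real_normed_vector \<Rightarrow>\<^sub>L real) \<times> 'b::real_normed_vector) list \<Rightarrow> ('a \<Rightarrow>\<^sub>L 'b)"
  where "rank_one_sum ps = (\<Sum>p\<leftarrow>ps. rank_one (fst p) (snd p))"

lemma rank_one_scaleR: "rank_one (r *\<^sub>R f) b = r *\<^sub>R rank_one f b"
  by (rule blinfun_eqI) (simp add: scaleR_blinfun.rep_eq)

lemma rank_one_sum_simps [simp]:
  "rank_one_sum [] = 0"
  "rank_one_sum (p # ps) = rank_one (fst p) (snd p) + rank_one_sum ps"
  "rank_one_sum (ps @ qs) = rank_one_sum ps + rank_one_sum qs"
  by (simp_all add: rank_one_sum_def)

lemma rank_one_sum_scaleR:
  "rank_one_sum (map (\<lambda>(f, x). (r *\<^sub>R f, x)) ps) = r *\<^sub>R rank_one_sum ps"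
  by (induction ps) (auto simp: rank_one_scaleR scaleR_add_right)

lemma rank_one_sum_concat_replicate:
  "rank_one_sum (concat (replicate n ps)) = real n *\<^sub>R rank_one_sum ps"
  by (induction n) (auto simp: scaleR_add_left)

text \<open>The functionals are the coordinates of \<open>T x\<close> in a basis of the range,
  bounded by \<open>independent_coefficients_bounded\<close>.\<close>

lemma finite_rank_imp_rank_one_sum:
  fixes T :: "'a::real_normed_vector \<Rightarrow>\<^sub>L 'b::real_normed_vector"
  assumes "finite_rank T"
  obtains ps where "\<forall>p\<in>set ps. norm (snd p) = 1" "rank_one_sum ps = T"
proof -
  obtain B0 where B0: "finite B0" "range T = span B0"
    using assms unfolding finite_rank_def by auto
  obtain B where B: "B \<subseteq> B0" "independent B" "B0 \<subseteq> span B"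
    using maximal_independent_subset[of B0] by blast
  have fin: "finite B" using B(1) B0(1) finite_subset by blast
  have T: "T x \<in> span B" for x
    using B0(2) B(3) span_minimal[OF B(3)] by (metis rangeI subset_iff subspace_span)
  obtain C where C: "C \<ge> 0" "\<And>c. (\<Sum>b\<in>B. \<bar>c b\<bar>) \<le> C * norm (\<Sum>b\<in>B. c b *\<^sub>R b)"
    using independent_coefficients_bounded[OF fin B(2)] by blast
  have sum: "(\<Sum>b\<in>B. representation B (T x) b *\<^sub>R b) = T x" for x
    by (rule sum_representation_eq[OF B(2) T fin]) simp
  define g where "g b = Blinfun (\<lambda>x. representation B (T x) b)" for b
  have g: "g b x = representation B (T x) b" if "b \<in> B" for b x
  proof -
    have "bounded_linear (\<lambda>x. representation B (T x) b)"
    proof (rule bounded_linear_intro[where K = "C * norm T"])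
      fix x y :: 'a and r :: real
      show "representation B (T (x + y)) b = representation B (T x) b + representation B (T y) b"
        by (simp add: blinfun.add_right representation_add[OF B(2) T T])
      show "representation B (T (r *\<^sub>R x)) b = r *\<^sub>R representation B (T x) b"
        by (simp add: blinfun.scaleR_right representation_scale[OF B(2) T])
      have "norm (representation B (T x) b) \<le> (\<Sum>b\<in>B. \<bar>representation B (T x) b\<bar>)"
        using that fin by (auto intro: member_le_sum)
      also have "\<dots> \<le> C * norm (T x)"
        using C(2)[of "representation B (T x)"] by (simp add: sum)
      also have "\<dots> \<le> C * (norm T * norm x)"
        using C(1) by (intro mult_left_mono norm_blinfun)
      finally show "norm (representation B (T x) b) \<le> norm x * (C * norm T)"
        by (simp add: mult_ac)
    qed
    then show ?thesis by (simp add: g_def bounded_linear_Blinfun_apply)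
  qed
  obtain bs where bs: "set bs = B" "distinct bs"
    using finite_distinct_list[OF fin] by blast
  have nz: "b \<noteq> 0" if "b \<in> B" for b
    using B(2) that dependent_zero by blast
  \<comment> \<open>The norm of \<open>b\<close> is moved to the functional, which leaves unit
    vectors and the same operators.\<close>
  define ps where "ps = map (\<lambda>b. (norm b *\<^sub>R g b, b /\<^sub>R norm b)) bs"
  have "rank_one_sum ps = (\<Sum>b\<in>B. rank_one (norm b *\<^sub>R g b) (b /\<^sub>R norm b))"
    using bs by (simp add: ps_def rank_one_sum_def o_def sum_list_distinct_conv_sum_set)
  also have "\<dots> = T"
  proof (rule blinfun_eqI)
    fix x
    have "(\<Sum>b\<in>B. rank_one (norm b *\<^sub>R g b) (b /\<^sub>R norm b)) x
        = (\<Sum>b\<in>B. representation B (T x) b *\<^sub>R b)"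
      using nz by (auto simp: blinfun.sum_left scaleR_blinfun.rep_eq g intro!: sum.cong)
    then show "(\<Sum>b\<in>B. rank_one (norm b *\<^sub>R g b) (b /\<^sub>R norm b)) x = T x"
      by (simp only: sum)
  qed
  finally show ?thesis
    using nz bs by (intro that[of ps]) (auto simp: ps_def)
qed

section \<open>Splitting one block into small steps\<close>

text \<open>Division with remainder for prefixes: the full copies will contribute an exact multiple
  of the total sum, and the incomplete copy the error.\<close>

lemma take_concat_replicate:
  assumes "m \<le> n * length xs"
  obtains q r where "q \<le> n" "r \<le> length xs"
    "take m (concat (replicate n xs)) = concat (replicate q xs) @ take r xs"
proof -
  have "\<exists>q\<le>n. \<exists>r\<le>length xs. take m (concat (replicate n xs)) = concat (replicate q xs) @ take r xs"
    using assms
  proof (induction n arbitrary: m)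
    case 0
    then show ?case by auto
  next
    case (Suc n)
    show ?case
    proof (cases "m \<le> length xs")
      case True
      then show ?thesis by (intro exI[of _ 0] exI[of _ m] conjI) auto
    next
      case False
      then obtain q r where "q \<le> n" "r \<le> length xs"
        "take (m - length xs) (concat (replicate n xs)) = concat (replicate q xs) @ take r xs"
        using Suc.IH[of "m - length xs"] Suc.prems by (auto simp: le_diff_conv)
      with False show ?thesis by (intro exI[of _ "Suc q"] exI[of _ r] conjI) auto
    qed
  qed
  then show ?thesis using that by blast
qed

text \<open>After \<open>q\<close> of \<open>n\<close> passes the sum is exactly
  \<open>q / n\<close> times the total, so \<open>t = q / n\<close>; the unfinished pass adds
  \<open>1 / n\<close> times a partial sum of \<open>ps\<close>, of which there are only finitely
  many.\<close>

lemma rank_one_sum_small_steps: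
  fixes ps :: "(('a::real_normed_vector \<Rightarrow>\<^sub>L real) \<times> 'b::real_normed_vector) list"
  assumes "ps \<noteq> []" "\<forall>p\<in>set ps. norm (snd p) = 1" "\<delta> > 0"
  obtains qs where "qs \<noteq> []" "\<forall>p\<in>set qs. norm (snd p) = 1 \<and> norm (fst p) \<le> 1"
    "rank_one_sum qs = rank_one_sum ps"
    "\<And>m. \<exists>t\<ge>0. t \<le> 1 \<and> norm (rank_one_sum (take m qs) - t *\<^sub>R rank_one_sum ps) \<le> \<delta>"
proof -
  \<comment> \<open>\<open>K\<close> dominates the norms of the functionals and of all partial sums
    of one pass, so a single large \<open>n\<close> makes the former at most 1 and the latter at
    most \<delta> after division.\<close>
  define K where "K = (\<Sum>p\<leftarrow>ps. norm (fst p)) + (\<Sum>r\<le>length ps. norm (rank_one_sum (take r ps)))"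
  have K1: "norm (fst p) \<le> K" if "p \<in> set ps" for p
  proof -
    have "norm (fst p) \<le> (\<Sum>p\<leftarrow>ps. norm (fst p))"
      using that by (intro member_le_sum_list) auto
    then show ?thesis unfolding K_def by (intro add_increasing2 sum_nonneg) auto
  qed
  have K2: "norm (rank_one_sum (take r ps)) \<le> K" if "r \<le> length ps" for r
  proof -
    have "norm (rank_one_sum (take r ps)) \<le> (\<Sum>r\<le>length ps. norm (rank_one_sum (take r ps)))"
      using that by (intro member_le_sum) auto
    then show ?thesis unfolding K_def by (intro add_increasing sum_list_nonneg) auto
  qed
  obtain n0 :: nat where "real n0 > max K (K / \<delta>)" using reals_Archimedean2 by blast
  then obtain n :: nat where n: "n > 0" "real n \<ge> K" "real n \<ge> K / \<delta>"
    using that[of "Suc n0"] by auto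
  have nd: "K / n \<le> 1" "K / n \<le> \<delta>"
    using n assms(3) by (auto simp: field_simps)
  define xs where "xs = map (\<lambda>(f, x). ((1 / n) *\<^sub>R f, x)) ps"
  define qs where "qs = concat (replicate n xs)"
  have xs: "rank_one_sum xs = (1 / n) *\<^sub>R rank_one_sum ps"
    unfolding xs_def by (rule rank_one_sum_scaleR)
  show ?thesis
  proof (rule that[of qs])
    show "qs \<noteq> []" using assms(1) n by (auto simp: qs_def xs_def)
    show "\<forall>p\<in>set qs. norm (snd p) = 1 \<and> norm (fst p) \<le> 1"
    proof
      fix q assume "q \<in> set qs"
      then have "q \<in> set xs" by (auto simp: qs_def split: if_splits)
      then obtain p where p: "p \<in> set ps" "q = ((1 / n) *\<^sub>R fst p, snd p)"
        by (auto simp: xs_def case_prod_beta)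
      have "norm (fst p) / n \<le> K / n"
        using K1[OF p(1)] by (intro divide_right_mono) auto
      with p nd(1) assms(2) show "norm (snd q) = 1 \<and> norm (fst q) \<le> 1" by simp
    qed
    show "rank_one_sum qs = rank_one_sum ps"
      using n by (simp add: qs_def rank_one_sum_concat_replicate xs)
    fix m
    have "take m qs = take (min m (length qs)) qs" by (simp add: min_def)
    moreover have "min m (length qs) \<le> n * length xs"
      by (simp add: qs_def length_concat sum_list_replicate)
    ultimately obtain q r where qr: "q \<le> n" "r \<le> length xs"
      "take m qs = concat (replicate q xs) @ take r xs"
      using take_concat_replicate qs_def by metis
    have "rank_one_sum (take r xs) = (1 / n) *\<^sub>R rank_one_sum (take r ps)"
      by (simp add: xs_def take_map rank_one_sum_scaleR)
    then have "rank_one_sum (take m qs) - (q / n) *\<^sub>R rank_one_sum ps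
        = (1 / n) *\<^sub>R rank_one_sum (take r ps)"
      by (simp add: qr(3) rank_one_sum_concat_replicate xs)
    moreover have "norm \<dots> \<le> K / n"
      using K2[of r] qr(2) by (simp add: xs_def divide_right_mono)
    ultimately show "\<exists>t\<ge>0. t \<le> 1 \<and> norm (rank_one_sum (take m qs) - t *\<^sub>R rank_one_sum ps) \<le> \<delta>"
      using qr(1) n(1) nd(2) by (intro exI[of _ "q / n"]) auto
  qed
qed

section \<open>Concatenating the blocks into one sequence\<close>

text \<open>\<open>L k\<close> is the position where the list \<open>ps k\<close> starts. Nonempty
  lists make \<open>L\<close> strictly increasing, so each position lies in exactly one block; this
  justifies the \<open>THE\<close> in the definition of \<open>e\<close>.\<close>

lemma concatenate_lists:
  fixes ps :: "nat \<Rightarrow> 'b list"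
  assumes "\<And>k. ps k \<noteq> []"
  obtains e L where "L 0 = 0" "strict_mono L" "\<And>k. L (Suc k) = L k + length (ps k)"
    "\<And>k i. i < length (ps k) \<Longrightarrow> e (L k + i) = ps k ! i"
    "\<And>n. \<exists>k. L k \<le> n \<and> n < L (Suc k)"
proof -
  define L where "L k = (\<Sum>i<k. length (ps i))" for k
  have mono: "strict_mono L"
    using assms by (auto simp: L_def strict_mono_Suc_iff)
  have "\<exists>k. L k \<le> n \<and> n < L (Suc k)" for n
  proof (induction n)
    case 0
    then show ?case using assms[of 0] by (intro exI[of _ 0]) (simp add: L_def)
  next
    case (Suc n)
    then obtain k where "L k \<le> n" "n < L (Suc k)" by blast
    moreover have "L (Suc k) < L (Suc (Suc k))" using mono by (simp add: strict_mono_Suc_iff)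
    ultimately show ?case
      by (cases "Suc n < L (Suc k)") (auto intro: exI[of _ k] exI[of _ "Suc k"])
  qed
  moreover define e where
    "e n = (let k = (THE k. L k \<le> n \<and> n < L (Suc k)) in ps k ! (n - L k))" for n
  have "e (L k + i) = ps k ! i" if "i < length (ps k)" for k i
  proof -
    have "(THE j. L j \<le> L k + i \<and> L k + i < L (Suc j)) = k"
    proof (rule the_equality)
      show "L k \<le> L k + i \<and> L k + i < L (Suc k)" using that by (simp add: L_def)
      fix j assume j: "L j \<le> L k + i \<and> L k + i < L (Suc j)"
      then have "L j < L (Suc k)" "L k < L (Suc j)" using that by (auto simp: L_def)
      then have "j < Suc k" "k < Suc j" using mono strict_mono_less by blast+
      then show "j = k" by simp
    qed
    then show ?thesis by (simp add: e_def)
  qed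
  ultimately show ?thesis using mono
    by (intro that[of L e]) (auto simp: L_def)
qed

section \<open>Norm estimates for signed sums and convex combinations\<close>

text \<open>The sum without \<open>A 1\<close> is the midpoint of the two signed sums that start
  with \<open>A 1\<close> and \<open>- A 1\<close>, so dropping the first term keeps the
  constant.\<close>

lemma norm_tail_signed_sum_le:
  assumes "sup_signed_sums A \<le> ereal c" "\<forall>i. \<theta> i = 1 \<or> \<theta> i = -1"
  shows "norm (\<Sum>i=1..N. \<theta> i *\<^sub>R A (Suc i)) \<le> c"
proof -
  define Y where "Y = (\<Sum>i=1..N. \<theta> i *\<^sub>R A (Suc i))"
  have *: "norm (s *\<^sub>R A 1 + Y) \<le> c" if "s = 1 \<or> s = -1" for s
  proof -
    \<comment> \<open>The irrelevant index 0 also receives \<open>s\<close>, because the signs are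
      required at every natural number.\<close>
    define \<eta> where "\<eta> i = (if i \<le> 1 then s else \<theta> (i - 1))" for i
    have "(\<Sum>i=1..Suc N. \<eta> i *\<^sub>R A i) = \<eta> 1 *\<^sub>R A 1 + (\<Sum>i=Suc 1..Suc N. \<eta> i *\<^sub>R A i)"
      by (subst sum.atLeast_Suc_atMost) auto
    also have "(\<Sum>i=Suc 1..Suc N. \<eta> i *\<^sub>R A i) = Y"
      unfolding sum.shift_bounds_cl_Suc_ivl Y_def by (intro sum.cong) (auto simp: \<eta>_def)
    finally have "(\<Sum>i=1..Suc N. \<eta> i *\<^sub>R A i) = s *\<^sub>R A 1 + Y" by (simp add: \<eta>_def)
    moreover have "norm (\<Sum>i=1..Suc N. \<eta> i *\<^sub>R A i) \<le> c"
      using assms that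
      by (intro sup_signed_sums_le_iff[THEN iffD1, rule_format]) (auto simp: \<eta>_def)
    ultimately show ?thesis by simp
  qed
  have "2 * norm Y = norm ((A 1 + Y) + (- A 1 + Y))"
    by (simp flip: scaleR_2)
  also have "\<dots> \<le> 2 * c"
    using norm_triangle_ineq[of "A 1 + Y" "- A 1 + Y"] *[of 1] *[of "-1"] by simp
  finally show ?thesis by (simp add: Y_def)
qed

text \<open>\<open>u + w\<close> lies within \<delta> of \<open>(1 - t) u + t v\<close>. The
  estimate serves twice: for operators in the bound on the partial sums, and for vectors in the
  convergence of the frame.\<close>

lemma norm_convex_perturbation_le:
  fixes u v w :: "'a::real_normed_vector"
  assumes "0 \<le> t" "t \<le> 1" "norm (w - t *\<^sub>R (v - u)) \<le> \<delta>"
  shows "norm (u + w) \<le> (1 - t) * norm u + t * norm v + \<delta>"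
proof -
  have "u + w = (1 - t) *\<^sub>R u + t *\<^sub>R v + (w - t *\<^sub>R (v - u))"
    by (simp add: algebra_simps)
  also have "norm \<dots> \<le> norm ((1 - t) *\<^sub>R u) + norm (t *\<^sub>R v) + norm (w - t *\<^sub>R (v - u))"
    by (intro norm_triangle_mono norm_triangle_ineq order_refl)
  finally show ?thesis using assms by simp
qed

section \<open>Construction of the frame\<close>

text \<open>The normalization is conditional on a nonzero vector, because the zero space has no
  vector of norm 1.\<close>

theorem lemma1p1:
  fixes l \<epsilon> :: real
  assumes "separable_space (euclidean :: 'a::banach topology)"
    and "has_UBAP TYPE('a) l"
    and "\<epsilon> > 0"
  shows "\<exists>(x :: nat \<Rightarrow> 'a) (f :: nat \<Rightarrow> ('a \<Rightarrow>\<^sub>L real)) (N :: nat \<Rightarrow> nat).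
    schauder_frame x f \<and>
    pos_subsequence N \<and>
    sup_signed_sums (frame_block x f N) \<le> ereal (l + \<epsilon>) \<and>
    (SUP M\<in>{1..}. ereal (norm (\<Sum>n=1..M. rank_one (f n) (x n)))) \<le> ereal (l + \<epsilon>) \<and>
    block_unconditional x f \<and>
    ((\<exists>z::'a. z \<noteq> 0) \<longrightarrow> (\<forall>n\<ge>1. norm (x n) = 1 \<and> norm (f n) \<le> 1))"
proof -
  \<comment> \<open>One half of \<epsilon> goes to the approximating sequence, the other to the
    deviation of partial sums from convex combinations.\<close>
  define c where "c = l + \<epsilon> / 2"
  obtain S :: "nat \<Rightarrow> 'a \<Rightarrow>\<^sub>L 'a" where S: "approximating_sequence S" "S 0 = 0"
    and sup: "sup_signed_sums (\<lambda>n. S n - S (n - 1)) \<le> ereal c"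
    using assms(2,3) unfolding has_UBAP_def c_def by (meson half_gt_zero)
  have S_lim: "(\<lambda>n. S n z) \<longlonglongrightarrow> z" for z
    using S(1) by (simp add: approximating_sequence_def)
  \<comment> \<open>With all signs equal to 1 the signed sum telescopes to \<open>S n\<close>; for
    \<open>n = 0\<close> only \<open>0 \<le> c\<close> is needed.\<close>
  have S_norm: "norm (S n) \<le> c" for n
  proof (cases "n = 0")
    case True
    have "norm (\<Sum>i=1..1::nat. 1 *\<^sub>R (S i - S (i - 1))) \<le> c"
      by (rule sup_signed_sums_le_iff[THEN iffD1, OF sup, rule_format, of 1 "\<lambda>_. 1"]) auto
    then have "0 \<le> c" by (rule order_trans[OF norm_ge_zero])
    then show ?thesis using True S(2) by simp
  next
    case False
    then have "norm (\<Sum>i=1..n. 1 *\<^sub>R (S i - S (i - 1))) \<le> c"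
      by (intro sup_signed_sums_le_iff[THEN iffD1, OF sup, rule_format, of n "\<lambda>_. 1"]) auto
    moreover have "(\<Sum>i=1..n. S i - S (i - 1)) = S n"
      by (induction n) (auto simp: S(2))
    ultimately show ?thesis by simp
  qed
  show ?thesis
  proof (cases "\<exists>z::'a. z \<noteq> 0")
    case False
    then have zero: "z = 0" for z :: 'a by blast
    have zero': "norm T = 0" for T :: "'a \<Rightarrow>\<^sub>L 'a"
      unfolding norm_eq_zero by (rule blinfun_eqI) (metis zero)
    have c: "0 \<le> l + \<epsilon>" using S_norm[of 0] assms(3) S(2) by (simp add: c_def)
    let ?x = "\<lambda>_::nat. 0::'a" and ?f = "\<lambda>_::nat. 0 :: 'a \<Rightarrow>\<^sub>L real" and ?N = "\<lambda>k::nat. k"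
    have "schauder_frame ?x ?f"
      unfolding schauder_frame_def
    proof
      fix z :: 'a
      show "(\<lambda>N. \<Sum>n=1..N. ?f n z *\<^sub>R ?x n) \<longlonglongrightarrow> z"
        using zero[of z] by simp
    qed
    moreover have "pos_subsequence ?N" by (simp add: pos_subsequence_def strict_mono_on_def)
    moreover have bl: "sup_signed_sums (frame_block ?x ?f ?N) \<le> ereal (l + \<epsilon>)"
      unfolding sup_signed_sums_le_iff zero' using c by simp
    moreover have "(SUP M\<in>{1..}. ereal (norm (\<Sum>n=1..M. rank_one (?f n) (?x n)))) \<le> ereal (l + \<epsilon>)"
      unfolding zero' using c by (simp add: SUP_le_iff)
    moreover have "block_unconditional ?x ?f"
      unfolding block_unconditional_def
    proof (intro exI conjI)
      show "sup_signed_sums (frame_block ?x ?f ?N) < \<infinity>"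
        using bl by (rule le_less_trans) simp
    qed fact
    ultimately show ?thesis using False by blast
  next
    case True
    then obtain z0 :: 'a where "z0 \<noteq> 0" by blast
    then have u: "norm (z0 /\<^sub>R norm z0) = 1" by simp
    have fr: "finite_rank (S n)" for n
    proof (cases "n = 0")
      case True
      then show ?thesis unfolding finite_rank_def
        by (intro exI[of _ "{}"]) (auto simp: S(2))
    next
      case False
      then show ?thesis using S(1) by (simp add: approximating_sequence_def)
    qed
    \<comment> \<open>The bound \<open>\<epsilon> / 2\<close> serves the norms of the partial sums,
      the limit 0 serves their convergence.\<close>
    define \<delta> where "\<delta> k = \<epsilon> / 2 / real (Suc k)" for k
    have \<delta>: "\<delta> k > 0" "\<delta> k \<le> \<epsilon> / 2" for k
      using assms(3) by (auto simp: \<delta>_def field_simps)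
    have \<delta>_lim: "\<delta> \<longlonglongrightarrow> 0"
      unfolding \<delta>_def using LIMSEQ_Suc[OF lim_const_over_n[of "\<epsilon> / 2"]] by simp
    let ?P = "\<lambda>k qs. qs \<noteq> [] \<and> (\<forall>p\<in>set qs. norm (snd p) = 1 \<and> norm (fst p) \<le> 1) \<and>
      rank_one_sum qs = S (Suc k) - S k \<and>
      (\<forall>m. \<exists>t\<ge>0. t \<le> 1 \<and> norm (rank_one_sum (take m qs) - t *\<^sub>R (S (Suc k) - S k)) \<le> \<delta> k)"
    have "\<exists>qs. ?P k qs" for k
    proof -
      obtain p1 where p1: "\<forall>p\<in>set p1. norm (snd p) = 1" "rank_one_sum p1 = S (Suc k)"
        using finite_rank_imp_rank_one_sum[OF fr] by blast
      obtain p2 where p2: "\<forall>p\<in>set p2. norm (snd p) = 1" "rank_one_sum p2 = S k"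
        using finite_rank_imp_rank_one_sum[OF fr] by blast
      \<comment> \<open>The null term keeps the block nonempty when \<open>S (Suc k) = S k\<close>.\<close>
      define ps where "ps = (0, z0 /\<^sub>R norm z0) # p1 @ map (\<lambda>(f, x). ((-1) *\<^sub>R f, x)) p2"
      have "rank_one (0 :: 'a \<Rightarrow>\<^sub>L real) (z0 /\<^sub>R norm z0) = 0"
        by (rule blinfun_eqI) simp
      then have ps: "rank_one_sum ps = S (Suc k) - S k"
        unfolding ps_def rank_one_sum_simps rank_one_sum_scaleR by (simp add: p1 p2)
      have "ps \<noteq> []" "\<forall>p\<in>set ps. norm (snd p) = 1"
        using u p1(1) p2(1) by (auto simp: ps_def)
      from rank_one_sum_small_steps[OF this \<delta>(1)[of k]] show ?thesis
        unfolding ps by metis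
    qed
    then obtain ps where ps: "\<And>k. ?P k (ps k)" by metis
    then obtain e L where L: "L 0 = 0" "strict_mono L" "\<And>k. L (Suc k) = L k + length (ps k)"
      and e: "\<And>k i. i < length (ps k) \<Longrightarrow> e (L k + i) = ps k ! i"
      and ex: "\<And>n. \<exists>k. L k \<le> n \<and> n < L (Suc k)"
      using concatenate_lists[of ps] by metis
    \<comment> \<open>Positions in \<open>e\<close> start at 0 and frame indices at 1, so block
      \<open>k\<close> occupies the indices from \<open>L k + 1\<close> to
      \<open>L (k + 1)\<close>.\<close>
    define x where "x n = snd (e (n - 1))" for n
    define f where "f n = fst (e (n - 1))" for n
    have segment: "(\<Sum>n = L k + 1..L k + m. rank_one (f n) (x n)) = rank_one_sum (take m (ps k))"
      if "m \<le> length (ps k)" for k m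
    proof -
      have "(\<Sum>n = L k + 1..L k + m. rank_one (f n) (x n))
          = (\<Sum>i<m. rank_one (fst (e (L k + i))) (snd (e (L k + i))))"
        by (rule sum.reindex_bij_witness[of _ "\<lambda>i. L k + i + 1" "\<lambda>n. n - L k - 1"])
           (auto simp: f_def x_def)
      also have "\<dots> = (\<Sum>i<m. rank_one (fst (ps k ! i)) (snd (ps k ! i)))"
        using that by (intro sum.cong) (auto simp: e)
      also have "\<dots> = rank_one_sum (take m (ps k))"
        using that by (simp add: rank_one_sum_def sum_list_sum_nth atLeast0LessThan)
      finally show ?thesis .
    qed
    have block: "frame_block x f L k = S (Suc k) - S k" for k
      using segment[of "length (ps k)" k] ps[of k] by (simp add: frame_block_def L(3))
    have initial: "(\<Sum>n=1..L k + m. rank_one (f n) (x n)) = S k + rank_one_sum (take m (ps k))"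
      if "m \<le> length (ps k)" for k m
    proof -
      have split: "(\<Sum>n=1..L k + m. rank_one (f n) (x n)) = (\<Sum>n=1..L k. rank_one (f n) (x n))
          + (\<Sum>n=L k + 1..L k + m. rank_one (f n) (x n))" for k m
        by (rule sum.ub_add_nat) simp
      have "(\<Sum>n=1..L k. rank_one (f n) (x n)) = S k"
      proof (induction k)
        case (Suc k)
        then show ?case
          using split[of k "length (ps k)"] segment[of "length (ps k)" k] ps[of k] by (simp add: L(3))
      qed (simp add: L(1) S(2))
      then show ?thesis using split[of k m] segment[OF that] by simp
    qed
    \<comment> \<open>The first \<open>M\<close> frame terms consist of all blocks before block
      \<open>K M\<close> and \<open>M - L (K M)\<close> terms of that block.\<close>
    obtain K where K: "\<And>n. L (K n) \<le> n" "\<And>n. n < L (Suc (K n))" using ex by metis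
    have partial: "\<exists>t w. 0 \<le> t \<and> t \<le> 1 \<and> norm (w - t *\<^sub>R (S (Suc (K M)) - S (K M))) \<le> \<delta> (K M) \<and>
        (\<Sum>n=1..M. rank_one (f n) (x n)) = S (K M) + w" for M
    proof -
      have "M - L (K M) \<le> length (ps (K M))" using K(2)[of M] L(3)[of "K M"] by simp
      from initial[OF this] K(1)[of M]
      have "(\<Sum>n=1..M. rank_one (f n) (x n)) = S (K M) + rank_one_sum (take (M - L (K M)) (ps (K M)))"
        by simp
      with ps[of "K M"] show ?thesis by blast
    qed
    have partial_norm: "norm (\<Sum>n=1..M. rank_one (f n) (x n)) \<le> l + \<epsilon>" for M
    proof -
      obtain t w where t: "0 \<le> t" "t \<le> 1" "norm (w - t *\<^sub>R (S (Suc (K M)) - S (K M))) \<le> \<delta> (K M)"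
        and w: "(\<Sum>n=1..M. rank_one (f n) (x n)) = S (K M) + w"
        using partial by metis
      have "norm (S (K M) + w) \<le> (1 - t) * norm (S (K M)) + t * norm (S (Suc (K M))) + \<delta> (K M)"
        by (rule norm_convex_perturbation_le[OF t])
      also have "\<dots> \<le> (1 - t) * c + t * c + \<epsilon> / 2"
        using t S_norm \<delta>(2) by (intro add_mono mult_left_mono) auto
      also have "\<dots> = l + \<epsilon>" by (simp add: c_def field_simps)
      finally show ?thesis using w by simp
    qed
    have K_top: "filterlim K at_top at_top"
      unfolding filterlim_at_top
    proof
      fix Z
      have "Z \<le> K M" if "M \<ge> L Z" for M
        using K(2)[of M] that L(2) by (metis le_less_trans less_Suc_eq_le strict_mono_less)
      then show "eventually (\<lambda>M. Z \<le> K M) at_top"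
        unfolding eventually_at_top_linorder by blast
    qed
    have frame: "schauder_frame x f"
      unfolding schauder_frame_def
    proof
      fix z :: 'a
      \<comment> \<open>The convex weights are bounded by 1, which makes \<open>E\<close>
        independent of the unknown \<open>t\<close>.\<close>
      define E where "E k = norm (S k z - z) + norm (S (Suc k) z - z) + \<delta> k * norm z" for k
      have "(\<lambda>k. norm (S k z - z)) \<longlonglongrightarrow> 0"
        using S_lim[of z] by (simp add: LIM_zero tendsto_norm_zero)
      then have "E \<longlonglongrightarrow> 0 + 0 + 0 * norm z"
        unfolding E_def using LIMSEQ_Suc by (intro tendsto_intros \<delta>_lim) auto
      then have "(\<lambda>M. E (K M)) \<longlonglongrightarrow> 0"
        using filterlim_compose[OF _ K_top] by force
      moreover have "norm ((\<Sum>n=1..M. f n z *\<^sub>R x n) - z) \<le> E (K M)" for M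
      proof -
        obtain t w where t: "0 \<le> t" "t \<le> 1" "norm (w - t *\<^sub>R (S (Suc (K M)) - S (K M))) \<le> \<delta> (K M)"
          and w: "(\<Sum>n=1..M. rank_one (f n) (x n)) = S (K M) + w"
          using partial by metis
        let ?u = "S (K M) z - z" and ?v = "S (Suc (K M)) z - z"
        \<comment> \<open>The two copies of \<open>z\<close> cancel in \<open>?v - ?u\<close>, so
          the operator estimate for \<open>w\<close> applies to the errors \<open>?u\<close> and
          \<open>?v\<close>.\<close>
        have "w z - t *\<^sub>R (?v - ?u) = (w - t *\<^sub>R (S (Suc (K M)) - S (K M))) z"
          by (simp add: minus_blinfun.rep_eq scaleR_blinfun.rep_eq)
        also have "norm \<dots> \<le> \<delta> (K M) * norm z"
          using norm_blinfun t(3) by (meson mult_right_mono norm_ge_zero order_trans)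
        finally have "norm (?u + w z) \<le> (1 - t) * norm ?u + t * norm ?v + \<delta> (K M) * norm z"
          by (rule norm_convex_perturbation_le[OF t(1,2)])
        also have "\<dots> \<le> E (K M)"
          unfolding E_def using t by (intro add_mono mult_left_le_one_le) auto
        also have "?u + w z = (\<Sum>n=1..M. f n z *\<^sub>R x n) - z"
          using arg_cong[OF w, of "\<lambda>T. blinfun_apply T z"]
          by (simp add: blinfun.sum_left plus_blinfun.rep_eq)
        finally show ?thesis .
      qed
      ultimately have "(\<lambda>M. (\<Sum>n=1..M. f n z *\<^sub>R x n) - z) \<longlonglongrightarrow> 0"
        by (rule Lim_null_comparison[OF always_eventually[OF allI], rotated])
      then show "(\<lambda>M. \<Sum>n=1..M. f n z *\<^sub>R x n) \<longlonglongrightarrow> z" by (rule LIM_zero_cancel)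
    qed
    \<comment> \<open>Strict monotonicity gives \<open>k \<le> L k\<close>, so \<open>L k\<close> is
      positive for \<open>k \<ge> 1\<close>; the value \<open>L 0 = 0\<close> is outside the
      subsequence.\<close>
    have subseq: "pos_subsequence L"
      using monotone_on_subset[OF L(2) subset_UNIV] strict_mono_imp_increasing[OF L(2)]
      by (auto simp: pos_subsequence_def intro: order_trans)
    \<comment> \<open>Block 0, which sums to \<open>S 1\<close>, lies before the index
      \<open>L 1\<close> is passed, so the signed sums start with \<open>S 2 - S 1\<close>. Hence
      the estimate for sums without the first term.\<close>
    have signed: "sup_signed_sums (frame_block x f L) \<le> ereal (l + \<epsilon>)"
      unfolding sup_signed_sums_le_iff block
    proof (intro allI impI)
      fix n and \<theta> :: "nat \<Rightarrow> real"
      assume "\<forall>i. \<theta> i = 1 \<or> \<theta> i = -1"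
      from norm_tail_signed_sum_le[OF sup this, of n] assms(3)
      show "norm (\<Sum>i=1..n. \<theta> i *\<^sub>R (S (Suc i) - S i)) \<le> l + \<epsilon>"
        by (simp add: c_def)
    qed
    have "block_unconditional x f"
      unfolding block_unconditional_def
    proof (intro exI conjI)
      show "sup_signed_sums (frame_block x f L) < \<infinity>"
        using signed by (rule le_less_trans) simp
    qed (rule subseq)
    moreover have "norm (x n) = 1 \<and> norm (f n) \<le> 1" for n
    proof -
      obtain k where k: "L k \<le> n - 1" "n - 1 < L (Suc k)" using ex by blast
      then have i: "n - 1 - L k < length (ps k)" by (simp add: L(3))
      then have "e (n - 1) = ps k ! (n - 1 - L k)" using e[OF i] by (simp only: le_add_diff_inverse[OF k(1)])
      then have "e (n - 1) \<in> set (ps k)" using i by simp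
      then show ?thesis using ps[of k] by (simp add: x_def f_def)
    qed
    moreover have "(SUP M\<in>{1..}. ereal (norm (\<Sum>n=1..M. rank_one (f n) (x n)))) \<le> ereal (l + \<epsilon>)"
      using partial_norm by (simp add: SUP_le_iff)
    ultimately show ?thesis using frame subseq signed by blast
  qed
qed

end
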